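(* Let $I\subseteq\mathbb{R}$ be an interval, let $f:I\to[0,\infty)$ be a Nesbitt-convex function, and let $a,b\in I$ with $a<b$. Then $$f\left(\frac{a+b}{2}\right)\le\frac{1}{b-a}\int_a^b f(x)\,dx\le \ln\left(\frac{3\sqrt3}{e}\right)\bigl(f(a)+f(b)\bigr).$$
   Context: Definition (Nesbitt-convex function). Let $I\subseteq\mathbb{R}$ be a nonempty interval. A function $f:I\to[0,\infty)$ is called Nesbitt-convex if $$f(tx+(1-t)y)\le\left(\frac{2t^2}{3-2t}+\frac{2t(1-t)}{1+2t}\right)f(x)+\left(\frac{2t(1-t)}{3-2t}+\frac{2(1-t)^2}{1+2t}\right)f(y)$$ for all $x,y\in I$ and all $t\in(0,1]$. *)

theory Defs
  imports "HOL-Analysis.Analysis"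
begin

text \<open>
  A function from \<open>I\<close> to the nonnegative reals is rendered as a total function whose values
  are constrained on \<open>I\<close> only.
\<close>

definition nesbitt_convex_on :: "real set \<Rightarrow> (real \<Rightarrow> real) \<Rightarrow> bool" where
  "nesbitt_convex_on I f \<longleftrightarrow>
     is_interval I \<and> I \<noteq> {} \<and> (\<forall>x\<in>I. 0 \<le> f x) \<and>
     (\<forall>x\<in>I. \<forall>y\<in>I. \<forall>t\<in>{0<..1}.
        f (t * x + (1 - t) * y)
          \<le> (2 * t\<^sup>2 / (3 - 2 * t) + 2 * t * (1 - t) / (1 + 2 * t)) * f x
            + (2 * t * (1 - t) / (3 - 2 * t) + 2 * (1 - t)\<^sup>2 / (1 + 2 * t)) * f y)"

end

theory Submission
  imports Defs
begin

text \<open>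
  At \<open>t = 1/2\<close> both Nesbitt weights equal \<open>1/2\<close>, so \<open>f\<close> is midpoint convex; since the weights
  are bounded, \<open>f\<close> is also bounded above on every segment of \<open>I\<close>. Together this makes \<open>f\<close> convex,
  so the classical Hermite-Hadamard inequality holds with constant \<open>1/2\<close>, and
  \<open>1/2 \<le> ln (3 * sqrt 3 / e)\<close> because \<open>e \<le> 3\<close>.
\<close>

text \<open>
  Subtracting the chord from \<open>f\<close> leaves a midpoint convex function \<open>h\<close> on \<open>[0, 1]\<close> vanishing at
  both ends. Each point is the midpoint of an endpoint and another point of \<open>[0, 1]\<close>, so
  \<open>M = sup h\<close> satisfies \<open>M \<le> M / 2\<close>, that is \<open>M \<le> 0\<close>.
\<close>

lemma midpoint_convex_bdd_above_imp_convex_on: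
  fixes f :: "'a::real_vector \<Rightarrow> real"
  assumes "convex S"
    and mid: "\<And>x y. x \<in> S \<Longrightarrow> y \<in> S \<Longrightarrow> f ((1/2) *\<^sub>R (x + y)) \<le> (f x + f y) / 2"
    and bdd: "\<And>x y. x \<in> S \<Longrightarrow> y \<in> S \<Longrightarrow> bdd_above (f ` closed_segment x y)"
  shows "convex_on S f"
proof
  fix t :: real and x y
  assume t: "0 < t" "t < 1" and xy: "x \<in> S" "y \<in> S"
  define p where "p s = (1 - s) *\<^sub>R x + s *\<^sub>R y" for s :: real
  define h where "h s = f (p s) - ((1 - s) * f x + s * f y)" for s
  have pS: "p s \<in> S" if "s \<in> {0..1}" for s
    using that xy \<open>convex S\<close> by (auto simp: p_def convex_alt)
  have h01: "h 0 = 0" "h 1 = 0"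
    by (simp_all add: h_def p_def)
  have hmid: "h ((r + s) / 2) \<le> (h r + h s) / 2" if "r \<in> {0..1}" "s \<in> {0..1}" for r s
  proof -
    have "1 - (r + s) / 2 = (1/2) * (1 - r) + (1/2) * (1 - s)" "(r + s) / 2 = (1/2) * r + (1/2) * s"
      by (simp_all add: field_simps)
    then have "p ((r + s) / 2) = (1/2) *\<^sub>R (p r + p s)"
      unfolding p_def by (simp only: scaleR_add_right scaleR_add_left scaleR_scaleR ac_simps)
    then have "f (p ((r + s) / 2)) \<le> (f (p r) + f (p s)) / 2"
      using mid pS that by metis
    then show ?thesis
      by (simp add: h_def field_simps)
  qed
  obtain B where bound: "\<And>z. z \<in> closed_segment x y \<Longrightarrow> f z \<le> B"
    using bdd[OF xy] by (meson bdd_above.E imageI)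
  have B: "f (p s) \<le> B" if "s \<in> {0..1}" for s
    using that by (intro bound) (auto simp: p_def closed_segment_def)
  \<comment> \<open>The supremum \<open>M\<close> is an upper bound of \<open>h\<close> only once
    the image is known to be bounded above; \<open>SUP\<close> of an unbounded set of reals is
    unspecified.\<close>
  have bddh: "bdd_above (h ` {0..1})"
  proof (rule bdd_aboveI2)
    fix s :: real assume s: "s \<in> {0..1}"
    have "\<bar>1 - s\<bar> * \<bar>f x\<bar> \<le> \<bar>f x\<bar>" "\<bar>s\<bar> * \<bar>f y\<bar> \<le> \<bar>f y\<bar>"
      using s by (auto intro!: mult_left_le_one_le)
    then have "- ((1 - s) * f x + s * f y) \<le> \<bar>f x\<bar> + \<bar>f y\<bar>"
      unfolding abs_mult[symmetric] by linarith
    with B[OF s] show "h s \<le> B + \<bar>f x\<bar> + \<bar>f y\<bar>"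
      by (simp add: h_def)
  qed
  define M where "M = (SUP s\<in>{0..1}. h s)"
  have le_M: "h s \<le> M" if "s \<in> {0..1}" for s
    using bddh that by (auto simp: M_def intro: cSUP_upper)
  have "h s \<le> M / 2" if s: "s \<in> {0..1}" for s
  proof (cases "s \<le> 1/2")
    case True
    with s have "h s \<le> (h 0 + h (2 * s)) / 2"
      using hmid[of 0 "2 * s"] by simp
    with True s le_M[of "2 * s"] show ?thesis
      by (simp add: h01)
  next
    case False
    with s have "h s \<le> (h 1 + h (2 * s - 1)) / 2"
      using hmid[of 1 "2 * s - 1"] by simp
    with False s le_M[of "2 * s - 1"] show ?thesis
      by (simp add: h01)
  qed
  then have "M \<le> M / 2"
    unfolding M_def by (intro cSUP_least) auto
  with le_M[of t] t have "h t \<le> 0"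
    by simp
  then show "f ((1 - t) *\<^sub>R x + t *\<^sub>R y) \<le> (1 - t) * f x + t * f y"
    by (simp add: h_def p_def)
qed fact

lemma nesbitt_convex_on_imp_convex_on:
  assumes "nesbitt_convex_on I f"
  shows "convex_on I f"
proof (rule midpoint_convex_bdd_above_imp_convex_on)
  have f0: "0 \<le> f x" if "x \<in> I" for x
    using assms that by (auto simp: nesbitt_convex_on_def)
  have nesbitt: "f (t * x + (1 - t) * y)
          \<le> (2 * t\<^sup>2 / (3 - 2 * t) + 2 * t * (1 - t) / (1 + 2 * t)) * f x
            + (2 * t * (1 - t) / (3 - 2 * t) + 2 * (1 - t)\<^sup>2 / (1 + 2 * t)) * f y"
    if "x \<in> I" "y \<in> I" "t \<in> {0<..1}" for x y t
    using assms that by (auto simp: nesbitt_convex_on_def)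
  show "convex I"
    using assms by (simp add: nesbitt_convex_on_def is_interval_convex)
  show "f ((1/2) *\<^sub>R (x + y)) \<le> (f x + f y) / 2" if "x \<in> I" "y \<in> I" for x y
    using nesbitt[OF that, of "1/2"] by (simp add: field_simps power2_eq_square)
  show "bdd_above (f ` closed_segment x y)" if xy: "x \<in> I" "y \<in> I" for x y
  proof (rule bdd_aboveI2)
    fix z assume "z \<in> closed_segment x y"
    then obtain u where u: "0 \<le> u" "u \<le> 1" "z = (1 - u) * x + u * y"
      by (auto simp: closed_segment_def)
    \<comment> \<open>Each weight is a sum of two quotients with numerator at most 2 and denominator
      at least 1, hence the factor 4.\<close>
    show "f z \<le> 4 * f x + 4 * f y"
    \<comment> \<open>Here \<open>u = 1\<close> is the excluded parameter \<open>t = 0\<close>: then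
      \<open>z = y\<close>, and nonnegativity of \<open>f\<close> gives the bound.\<close>
    proof (cases "u = 1")
      case True
      with u f0[OF xy(1)] f0[OF xy(2)] show ?thesis
        by simp
    next
      case False
      define t where "t = 1 - u"
      have t: "0 < t" "t \<le> 1"
        using u False by (auto simp: t_def)
      have quot: "2 * (a * b) / c \<le> 2" if "0 \<le> a" "a \<le> 1" "0 \<le> b" "b \<le> 1" "1 \<le> c" for a b c :: real
        using that mult_le_one[of a b] by (simp add: field_simps)
      have "2 * t\<^sup>2 / (3 - 2 * t) + 2 * t * (1 - t) / (1 + 2 * t) \<le> 4"
        using quot[of t t "3 - 2 * t"] quot[of t "1 - t" "1 + 2 * t"] t
        by (simp add: power2_eq_square mult.assoc)
      moreover have "2 * t * (1 - t) / (3 - 2 * t) + 2 * (1 - t)\<^sup>2 / (1 + 2 * t) \<le> 4"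
        using quot[of t "1 - t" "3 - 2 * t"] quot[of "1 - t" "1 - t" "1 + 2 * t"] t
        by (simp add: power2_eq_square mult.assoc)
      moreover have "f z \<le> (2 * t\<^sup>2 / (3 - 2 * t) + 2 * t * (1 - t) / (1 + 2 * t)) * f x
            + (2 * t * (1 - t) / (3 - 2 * t) + 2 * (1 - t)\<^sup>2 / (1 + 2 * t)) * f y"
        using nesbitt[OF xy, of t] t u by (simp add: t_def)
      ultimately show ?thesis
        by (meson add_mono f0 mult_right_mono order_trans xy)
    qed
  qed
qed

text \<open>Reflection in the midpoint swaps the barycentric weights of \<open>x\<close>, so the two
  chord bounds add up to the endpoint values.\<close>

lemma convex_on_reflect_le:
  fixes f :: "real \<Rightarrow> real"
  assumes "convex_on {a..b} f" "x \<in> {a..b}"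
  shows "f x + f (a + b - x) \<le> f a + f b"
proof (cases "a = b")
  case False
  then have ab: "a < b"
    using assms(2) by auto
  define s where "s = (x - a) / (b - a)"
  have s: "0 \<le> s" "s \<le> 1" "x = a + s * (b - a)"
    using assms(2) ab by (auto simp: s_def field_simps)
  have eqs: "(1 - s) *\<^sub>R a + s *\<^sub>R b = x" "(1 - (1 - s)) *\<^sub>R a + (1 - s) *\<^sub>R b = a + b - x"
    using s by (simp_all add: algebra_simps)
  have "f x \<le> (1 - s) * f a + s * f b"
    using convex_onD_Icc[OF assms(1), of s] ab s eqs by simp
  moreover have "f (a + b - x) \<le> s * f a + (1 - s) * f b"
    using convex_onD_Icc[OF assms(1), of "1 - s"] ab s eqs by simp
  ultimately show ?thesis
    by (simp add: algebra_simps)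
qed (use assms in auto)

text \<open>The midpoint of \<open>x\<close> and its mirror image is the centre of the interval,
  whatever \<open>x\<close> is.\<close>

lemma convex_on_le_reflect:
  fixes f :: "real \<Rightarrow> real"
  assumes "convex_on {a..b} f" "x \<in> {a..b}"
  shows "2 * f ((a + b) / 2) \<le> f x + f (a + b - x)"
proof -
  have "(1 - 1/2) *\<^sub>R x + (1/2) *\<^sub>R (a + b - x) = (a + b) / 2"
    by (simp add: field_simps)
  then show ?thesis
    using convex_onD[OF assms(1), of "1/2" x "a + b - x"] assms(2) by (simp add: field_simps)
qed

text \<open>
  A convex function may jump at \<open>a\<close> and \<open>b\<close>, hence the passage to the open interval, where it is
  continuous.
\<close>

lemma convex_on_integrable_Icc:
  fixes f :: "real \<Rightarrow> real"
  assumes "convex_on {a..b} f"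
  shows "f integrable_on {a..b}"
proof -
  define B where "B = max (f a) (f b)"
  have upper: "f x \<le> B" if x: "x \<in> {a..b}" for x
  proof -
    have "x \<in> closed_segment a b"
      using x by (simp add: closed_segment_eq_real_ivl)
    then obtain s where s: "0 \<le> s" "s \<le> 1" "x = (1 - s) *\<^sub>R a + s *\<^sub>R b"
      by (auto simp: closed_segment_def)
    have "f x \<le> (1 - s) * f a + s * f b"
      using convex_onD_Icc[OF assms, of s] x s by auto
    also have "\<dots> \<le> B"
      using s by (intro convex_bound_le) (auto simp: B_def)
    finally show ?thesis .
  qed
  \<comment> \<open>Reflection turns the upper bound \<open>B\<close> at the mirror point into a
    lower bound at \<open>x\<close>.\<close>
  have lower: "2 * f ((a + b) / 2) - B \<le> f x" if "x \<in> {a..b}" for x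
    using convex_on_le_reflect[OF assms that] upper[of "a + b - x"] that by simp
  define C where "C = \<bar>B\<bar> + \<bar>2 * f ((a + b) / 2) - B\<bar>"
  have "continuous_on {a<..<b} f"
    by (intro convex_on_continuous convex_on_subset[OF assms]) auto
  then have "f \<in> borel_measurable (lebesgue_on {a<..<b})"
    by (rule continuous_imp_measurable_on_sets_lebesgue) simp
  moreover have "(\<lambda>_. C) integrable_on {a<..<b}"
    unfolding integrable_on_Icc_iff_Ioo[symmetric] by (rule integrable_const_ivl)
  moreover have "\<bar>f x\<bar> \<le> C" if "x \<in> {a<..<b}" for x
    using upper[of x] lower[of x] that by (auto simp: C_def)
  ultimately have "f integrable_on {a<..<b}"
    by (rule measurable_bounded_by_integrable_imp_integrable_real) simp_all
  then show ?thesis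
    by (simp add: integrable_on_Icc_iff_Ioo)
qed

text \<open>Reflection preserves the integral, so twice the integral of \<open>f\<close> is that of
  \<open>f x + f (a + b - x)\<close>, which lies pointwise between two constants.\<close>

lemma hermite_hadamard:
  fixes f :: "real \<Rightarrow> real"
  assumes cvx: "convex_on {a..b} f" and ab: "a < b"
  shows "f ((a + b) / 2) \<le> 1 / (b - a) * integral {a..b} f"
    and "1 / (b - a) * integral {a..b} f \<le> (f a + f b) / 2"
proof -
  let ?J = "integral {a..b} f"
  have f: "(f has_integral ?J) {a..b}"
    using convex_on_integrable_Icc[OF cvx] by (rule integrable_integral)
  have img: "(\<lambda>x. a + b - x) ` {a..b} = {a..b}"
    using image_affinity_atLeastAtMost[of "-1" "a + b" a b] ab by (simp add: algebra_simps)
  have "((\<lambda>x. f (a + b - x)) has_integral ?J) {a..b}"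
    using has_integral_affinity[of f ?J a b "-1" "a + b"] f ab img by simp
  from has_integral_add[OF f this]
  have g: "((\<lambda>x. f x + f (a + b - x)) has_integral 2 * ?J) {a..b}"
    by simp
  have const: "((\<lambda>_. c) has_integral (b - a) * c) {a..b}" for c :: real
    using has_integral_const_real[of c a b] ab by simp
  have "(b - a) * (2 * f ((a + b) / 2)) \<le> 2 * ?J"
    by (rule has_integral_le[OF const g]) (rule convex_on_le_reflect[OF cvx])
  then show "f ((a + b) / 2) \<le> 1 / (b - a) * ?J"
    using ab by (simp add: field_simps)
  have "2 * ?J \<le> (b - a) * (f a + f b)"
    by (rule has_integral_le[OF g const]) (rule convex_on_reflect_le[OF cvx])
  then show "1 / (b - a) * ?J \<le> (f a + f b) / 2"
    using ab by (simp add: field_simps)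
qed

text \<open>The logarithm is \<open>3/2 * ln 3 - 1\<close>, the integral of either Nesbitt weight
  over \<open>t\<close> in [0, 1].\<close>

lemma half_le_ln_3_sqrt_3_div_exp_1: "1 / 2 \<le> ln (3 * sqrt 3 / exp 1 :: real)"
proof -
  have "1 \<le> ln (3::real)"
    using exp_le by (simp add: ln_ge_iff)
  moreover have "ln (3 * sqrt 3 / exp 1 :: real) = ln 3 + ln 3 / 2 - 1"
    by (simp add: ln_div ln_mult ln_sqrt)
  ultimately show ?thesis
    by simp
qed

theorem theorem6:
  fixes I :: "real set" and f :: "real \<Rightarrow> real" and a b :: real
  assumes "is_interval I"
    and "nesbitt_convex_on I f"
    and "a \<in> I" and "b \<in> I" and "a < b"
  shows "f integrable_on {a..b}
    \<and> f ((a + b) / 2) \<le> 1 / (b - a) * integral {a..b} f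
    \<and> 1 / (b - a) * integral {a..b} f \<le> ln (3 * sqrt 3 / exp 1) * (f a + f b)"
proof -
  have "{a..b} \<subseteq> I"
    using assms by (meson atLeastAtMost_iff is_interval_1 subsetI)
  then have cvx: "convex_on {a..b} f"
    using convex_on_subset[OF nesbitt_convex_on_imp_convex_on[OF assms(2)]] by simp
  \<comment> \<open>Nonnegativity allows the factor 1/2 to be enlarged to the logarithm.\<close>
  have "0 \<le> f a + f b"
    using assms by (simp add: nesbitt_convex_on_def)
  then have "(f a + f b) / 2 \<le> ln (3 * sqrt 3 / exp 1) * (f a + f b)"
    using mult_right_mono[OF half_le_ln_3_sqrt_3_div_exp_1] by fastforce
  with hermite_hadamard[OF cvx \<open>a < b\<close>] convex_on_integrable_Icc[OF cvx] show ?thesis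
    by (blast intro: order_trans)
qed

end
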